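(* Let $d\ge1$ and let $f\in C^2(0,+\infty)$ be a convex function with $f(1)=0$ and $f''(1)>0$. Then there exists $\alpha_{\chi^2,f}>0$, depending on $f$ only, such that for any positive probability densities $\rho$ and $\rho^*$ on $\mathbb R^d$ for which $f'(\rho/\rho^* )$ is absolutely integrable with respect to $\rho$, both of the following inequalities hold: $$-\int\Bigl(-\rho f'\bigl(\tfrac{\rho}{\rho^*}\bigr)+\rho\,\mathbb E_\rho\bigl[f'\bigl(\tfrac{\rho}{\rho^*}\bigr)\bigr]\Bigr)\Bigl(1-\bigl(\tfrac{\rho^*}{\rho}\bigr)^2\Bigr)d\theta\ge D_f[\rho\Vert\rho^*],$$ $$-\int\Bigl(-\rho f'\bigl(\tfrac{\rho}{\rho^*}\bigr)+\rho\,\mathbb E_\rho\bigl[f'\bigl(\tfrac{\rho}{\rho^*}\bigr)\bigr]\Bigr)\Bigl(1-\bigl(\tfrac{\rho^*}{\rho}\bigr)^2\Bigr)d\theta\ge\alpha_{\chi^2,f}\,\chi^2[\rho^*\Vert\rho].$$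
   Context: $D_f[\rho\Vert\rho^*]=\int\rho^*f(\rho/\rho^* )\,d\theta$, $\chi^2[\rho^*\Vert\rho]=\int\frac{(\rho^* )^2}{\rho}\,d\theta-1$, and $\mathbb E_\rho[\psi]=\int\rho\,\psi\,d\theta$. All these quantities and the left-hand sides are understood as elements of $(-\infty,+\infty]$. *)

theory Defs
  imports "HOL-Analysis.Analysis"
begin

text \<open>
  Points of \<open>\<real>\<^sup>d\<close> are the extensional functions on \<open>{..<d}\<close>, so that the dimension is a
  term and a constant can be chosen uniformly in it. Completing the product of the one-dimensional
  Borel--Lebesgue measures gives Lebesgue measure, hence densities need only be
  Lebesgue measurable.
\<close>

definition lebesgue_Rd :: "nat \<Rightarrow> (nat \<Rightarrow> real) measure" where
  "lebesgue_Rd d = completion (Pi\<^sub>M {..<d} (\<lambda>_. lborel))"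

definition positive_density :: "nat \<Rightarrow> ((nat \<Rightarrow> real) \<Rightarrow> real) \<Rightarrow> bool" where
  "positive_density d \<rho> \<longleftrightarrow>
     \<rho> \<in> borel_measurable (lebesgue_Rd d) \<and>
     (\<forall>\<theta>\<in>space (lebesgue_Rd d). \<rho> \<theta> > 0) \<and>
     (\<integral>\<^sup>+\<theta>. ennreal (\<rho> \<theta>) \<partial>lebesgue_Rd d) = 1"

text \<open>
  The integral with values in \<open>[-\<infinity>, \<infinity>]\<close>. Since \<open>\<infinity> - \<infinity> = \<infinity>\<close> in \<open>ereal\<close>, its value is
  meaningful only together with \<open>quasi_integrable\<close>; \<open>ennreal\<close> maps negative reals to 0, so the two
  terms are the integrals of the positive and the negative part.
\<close>

definition ext_integral :: "'a measure \<Rightarrow> ('a \<Rightarrow> real) \<Rightarrow> ereal" where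
  "ext_integral M g =
     enn2ereal (\<integral>\<^sup>+x. ennreal (g x) \<partial>M) - enn2ereal (\<integral>\<^sup>+x. ennreal (- g x) \<partial>M)"

definition quasi_integrable :: "'a measure \<Rightarrow> ('a \<Rightarrow> real) \<Rightarrow> bool" where
  "quasi_integrable M g \<longleftrightarrow>
     g \<in> borel_measurable M \<and>
     ((\<integral>\<^sup>+x. ennreal (g x) \<partial>M) < \<infinity> \<or> (\<integral>\<^sup>+x. ennreal (- g x) \<partial>M) < \<infinity>)"

definition f_div_integrand ::
  "(real \<Rightarrow> real) \<Rightarrow> ('a \<Rightarrow> real) \<Rightarrow> ('a \<Rightarrow> real) \<Rightarrow> 'a \<Rightarrow> real" where
  "f_div_integrand f \<rho> \<rho>' \<theta> = \<rho>' \<theta> * f (\<rho> \<theta> / \<rho>' \<theta>)"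

definition f_div ::
  "(real \<Rightarrow> real) \<Rightarrow> nat \<Rightarrow> ((nat \<Rightarrow> real) \<Rightarrow> real) \<Rightarrow> ((nat \<Rightarrow> real) \<Rightarrow> real) \<Rightarrow> ereal" where
  "f_div f d \<rho> \<rho>' = ext_integral (lebesgue_Rd d) (f_div_integrand f \<rho> \<rho>')"

definition chi2_div ::
  "nat \<Rightarrow> ((nat \<Rightarrow> real) \<Rightarrow> real) \<Rightarrow> ((nat \<Rightarrow> real) \<Rightarrow> real) \<Rightarrow> ereal" where
  "chi2_div d \<rho>' \<rho> = enn2ereal (\<integral>\<^sup>+\<theta>. ennreal ((\<rho>' \<theta>)\<^sup>2 / \<rho> \<theta>) \<partial>lebesgue_Rd d) - 1"

definition density_expectation ::
  "nat \<Rightarrow> ((nat \<Rightarrow> real) \<Rightarrow> real) \<Rightarrow> ((nat \<Rightarrow> real) \<Rightarrow> real) \<Rightarrow> real" where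
  "density_expectation d \<rho> \<psi> = (\<integral>\<theta>. \<rho> \<theta> * \<psi> \<theta> \<partial>lebesgue_Rd d)"

definition dissipation_integrand ::
  "(real \<Rightarrow> real) \<Rightarrow> nat \<Rightarrow> ((nat \<Rightarrow> real) \<Rightarrow> real) \<Rightarrow> ((nat \<Rightarrow> real) \<Rightarrow> real)
    \<Rightarrow> (nat \<Rightarrow> real) \<Rightarrow> real" where
  "dissipation_integrand f d \<rho> \<rho>' \<theta> =
     (- \<rho> \<theta> * deriv f (\<rho> \<theta> / \<rho>' \<theta>)
        + \<rho> \<theta> * density_expectation d \<rho> (\<lambda>\<eta>. deriv f (\<rho> \<eta> / \<rho>' \<eta>)))
     * (1 - (\<rho>' \<theta> / \<rho> \<theta>)\<^sup>2)"

end

theory Submission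
  imports Defs "HOL-Probability.Probability_Measure"
begin

text \<open>
  Under the probability measure with density \<open>\<rho>\<close> the variable \<open>X = \<rho>' / \<rho>\<close> has mean 1, and minus
  the dissipation integrand becomes \<open>h = (X\<^sup>2 - 1) (\<phi>(X) - c)\<close> with the increasing function
  \<open>\<phi>(t) = f'(1) - f'(1/t)\<close> and \<open>c = E[\<phi>(X)]\<close>. Monotonicity gives
  \<open>X (X - N) (\<phi>(X) - \<phi>(N)) \<ge> 0\<close> for every \<open>N > 0\<close>. Choosing \<open>N\<close> with \<open>\<phi>(N) > c\<close> yields
  quasi-integrability and shows that \<open>X\<^sup>2\<close> is integrable whenever \<open>h\<close> is; choosing \<open>N = E[X\<^sup>2]\<close>
  yields \<open>E[h] \<ge> E[X\<^sup>2] E[(X - 1) \<phi>(X)]\<close>. Convexity of \<open>f\<close> bounds the divergence by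
  \<open>E[(X - 1) \<phi>(X)]\<close>, and \<open>f''(1) > 0\<close> makes \<open>(X - 1) \<phi>(X)\<close> control \<open>(X - 1)\<^sup>2\<close> for bounded \<open>X\<close>.
\<close>

section \<open>Extended-valued integrals under a change of density\<close>

lemma ext_integral_density:
  assumes "w \<in> borel_measurable M" "\<And>x. x \<in> space M \<Longrightarrow> 0 \<le> w x" "g \<in> borel_measurable M"
  shows "ext_integral (density M w) g = ext_integral M (\<lambda>x. w x * g x)"
proof -
  have "(\<integral>\<^sup>+x. ennreal (u x) \<partial>density M w) = (\<integral>\<^sup>+x. ennreal (w x * u x) \<partial>M)"
    if "u \<in> borel_measurable M" for u
    using assms that by (auto simp: nn_integral_density ennreal_mult' intro!: nn_integral_cong)
  from this[of g] this[of "\<lambda>x. - g x"] show ?thesis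
    using assms by (simp add: ext_integral_def)
qed

lemma quasi_integrable_density:
  assumes "w \<in> borel_measurable M" "\<And>x. x \<in> space M \<Longrightarrow> 0 \<le> w x" "g \<in> borel_measurable M"
    and "quasi_integrable (density M w) g"
  shows "quasi_integrable M (\<lambda>x. w x * g x)"
proof -
  have "(\<integral>\<^sup>+x. ennreal (u x) \<partial>density M w) = (\<integral>\<^sup>+x. ennreal (w x * u x) \<partial>M)"
    if "u \<in> borel_measurable M" for u
    using assms that by (auto simp: nn_integral_density ennreal_mult' intro!: nn_integral_cong)
  from this[of g] this[of "\<lambda>x. - g x"] show ?thesis
    using assms by (simp add: quasi_integrable_def)
qed

lemma ext_integral_cong:
  "(\<And>x. x \<in> space M \<Longrightarrow> g x = h x) \<Longrightarrow> ext_integral M g = ext_integral M h"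
  by (simp add: ext_integral_def cong: nn_integral_cong)

lemma quasi_integrable_cong:
  assumes "\<And>x. x \<in> space M \<Longrightarrow> g x = h x"
  shows "quasi_integrable M g \<longleftrightarrow> quasi_integrable M h"
proof -
  have "(\<integral>\<^sup>+x. ennreal (g x) \<partial>M) = (\<integral>\<^sup>+x. ennreal (h x) \<partial>M)"
    "(\<integral>\<^sup>+x. ennreal (- g x) \<partial>M) = (\<integral>\<^sup>+x. ennreal (- h x) \<partial>M)"
    "g \<in> borel_measurable M \<longleftrightarrow> h \<in> borel_measurable M"
    using assms by (auto intro!: nn_integral_cong measurable_cong)
  then show ?thesis by (simp add: quasi_integrable_def)
qed

lemma quasi_integrable_uminus: "quasi_integrable M (\<lambda>x. - g x) \<longleftrightarrow> quasi_integrable M g"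
  by (auto simp: quasi_integrable_def)

lemma ext_integral_integrable:
  assumes "integrable M g"
  shows "ext_integral M g = ereal (integral\<^sup>L M g)"
proof -
  have fin: "(\<integral>\<^sup>+x. ennreal (g x) \<partial>M) \<noteq> \<infinity>" "(\<integral>\<^sup>+x. ennreal (- g x) \<partial>M) \<noteq> \<infinity>"
    using assms by (auto simp: real_integrable_def)
  then show ?thesis
    by (cases "\<integral>\<^sup>+x. ennreal (g x) \<partial>M"; cases "\<integral>\<^sup>+x. ennreal (- g x) \<partial>M")
      (auto simp: ext_integral_def real_lebesgue_integral_def[OF assms])
qed

lemma nn_integral_neg_part_finite:
  assumes "integrable M l" "\<And>x. x \<in> space M \<Longrightarrow> l x \<le> g x"
  shows "(\<integral>\<^sup>+x. ennreal (- g x) \<partial>M) < \<infinity>"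
proof -
  have "(\<integral>\<^sup>+x. ennreal (- g x) \<partial>M) \<le> (\<integral>\<^sup>+x. ennreal (- l x) \<partial>M)"
    by (intro nn_integral_mono ennreal_leI) (use assms in auto)
  also have "\<dots> < \<infinity>" using assms(1) by (simp add: real_integrable_def top.not_eq_extremum)
  finally show ?thesis .
qed

text \<open>An integrable minorant makes the integral of the negative part finite, which excludes
  the meaningless case \<open>\<infinity> - \<infinity>\<close>.\<close>

lemma quasi_integrable_lower_bound:
  assumes "g \<in> borel_measurable M" "integrable M l" "\<And>x. x \<in> space M \<Longrightarrow> l x \<le> g x"
  shows "quasi_integrable M g" "ext_integral M g > -\<infinity>"
proof -
  have fin: "(\<integral>\<^sup>+x. ennreal (- g x) \<partial>M) < \<infinity>"
    using assms(2,3) by (rule nn_integral_neg_part_finite)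
  then show "quasi_integrable M g" using assms(1) by (simp add: quasi_integrable_def)
  show "ext_integral M g > -\<infinity>" unfolding ext_integral_def
    using fin by (cases "\<integral>\<^sup>+x. ennreal (g x) \<partial>M"; cases "\<integral>\<^sup>+x. ennreal (- g x) \<partial>M") auto
qed

text \<open>The negative part of \<open>g\<close> has finite integral, so only the positive part can
  diverge. Either the value is \<open>\<infinity>\<close> and every upper estimate by it is trivial,
  or \<open>g\<close> is integrable and the estimate concerns real expectations. The two minus signs
  match the sign of the dissipation integrand.\<close>

lemma ext_integral_uminus_cases:
  assumes "g \<in> borel_measurable M" "integrable M l" "\<And>x. x \<in> space M \<Longrightarrow> l x \<le> g x"
  obtains "integrable M g" "- ext_integral M (\<lambda>x. - g x) = ereal (integral\<^sup>L M g)"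
  | "- ext_integral M (\<lambda>x. - g x) = \<infinity>"
proof (cases "(\<integral>\<^sup>+x. ennreal (g x) \<partial>M) = \<infinity>")
  case True
  have "(\<integral>\<^sup>+x. ennreal (- g x) \<partial>M) < \<infinity>"
    using assms(2,3) by (rule nn_integral_neg_part_finite)
  with True show ?thesis using that(2)
    by (cases "\<integral>\<^sup>+x. ennreal (- g x) \<partial>M") (auto simp: ext_integral_def)
next
  case False
  have "(\<integral>\<^sup>+x. ennreal (- g x) \<partial>M) < \<infinity>"
    using assms(2,3) by (rule nn_integral_neg_part_finite)
  with False assms(1) have int: "integrable M g" by (auto simp: real_integrable_def)
  then have "integrable M (\<lambda>x. - g x)" by simp
  from ext_integral_integrable[OF this] int that(1) show ?thesis by simp
qed

section \<open>Random variables of mean one and an increasing function\<close>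

locale unit_mean_variable = prob_space +
  fixes X :: "'a \<Rightarrow> real" and \<phi> :: "real \<Rightarrow> real"
  assumes X_pos: "\<And>x. x \<in> space M \<Longrightarrow> X x > 0"
    and X_int: "integrable M X"
    and X_mean: "expectation X = 1"
    and \<phi>_mono: "mono_on {0<..} \<phi>"
    and \<phi>_one: "\<phi> 1 = 0"
    and \<phi>_int: "integrable M (\<lambda>x. \<phi> (X x))"
begin

definition c where "c = expectation (\<lambda>x. \<phi> (X x))"

definition h where "h x = ((X x)\<^sup>2 - 1) * (\<phi> (X x) - c)"

lemma h_measurable: "h \<in> borel_measurable M"
proof -
  have [measurable]: "X \<in> borel_measurable M" "(\<lambda>x. \<phi> (X x)) \<in> borel_measurable M"
    using X_int \<phi>_int by auto
  show ?thesis unfolding h_def[abs_def] by measurable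
qed

text \<open>This is monotonicity in the product form
  \<open>(t - u) * (\<phi> t - \<phi> u) \<ge> 0\<close>, which does not ask which of the two points
  is larger.\<close>

lemma le_mult_\<phi>:
  assumes "t > 0" "u > 0"
  shows "(t - u) * \<phi> u \<le> (t - u) * \<phi> t"
proof (cases "u \<le> t")
  case True
  then show ?thesis
    using monotone_onD[OF \<phi>_mono, of u t] assms by (intro mult_left_mono) auto
next
  case False
  then show ?thesis
    using monotone_onD[OF \<phi>_mono, of t u] assms by (intro mult_left_mono_neg) auto
qed

lemma mult_\<phi>_nonneg: "t > 0 \<Longrightarrow> 0 \<le> (t - 1) * \<phi> t"
  using le_mult_\<phi>[of t 1] by (simp add: \<phi>_one)

text \<open>
  For \<open>N = E[X\<^sup>2]\<close> the last three terms of the lower bound have mean zero.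
\<close>

lemma h_lower_bound:
  assumes x: "x \<in> space M" and N: "N > 0"
  shows "N * ((X x - 1) * \<phi> (X x)) + ((N - 1) * (\<phi> (X x) - c) - N * c * (X x - 1)
    + (\<phi> N - c) * ((X x)\<^sup>2 - N * X x)) \<le> h x"
proof -
  \<comment> \<open>The two sides of the claim differ by exactly
    \<open>X x * (X x - N) * (\<phi> (X x) - \<phi> N)\<close>.\<close>
  have "X x * ((X x - N) * \<phi> N) \<le> X x * ((X x - N) * \<phi> (X x))"
    using le_mult_\<phi>[OF X_pos[OF x] N] X_pos[OF x] by (rule mult_left_mono[OF _ less_imp_le])
  then show ?thesis
    unfolding h_def by (simp add: algebra_simps power2_eq_square)
qed

text \<open>A variable that never exceeds its mean equals it almost surely, so
  \<open>\<phi> (X x) = c\<close> almost everywhere. Then \<open>(X x - 1) * \<phi> (X x)\<close>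
  has mean zero, and being nonnegative it vanishes almost everywhere. By \<open>low\<close> and
  monotonicity, 1 is the only zero of \<open>\<phi>\<close>. This settles the degenerate case in
  which \<open>\<phi>\<close> never exceeds \<open>c\<close>.\<close>

lemma AE_one_if_bounded_by_mean:
  assumes b: "b > 0" and Y: "Y > 1"
    and low: "\<And>t. 0 < t \<Longrightarrow> t \<le> Y \<Longrightarrow> b * (t - 1)\<^sup>2 \<le> (t - 1) * \<phi> t"
    and bound: "\<And>t. t > 0 \<Longrightarrow> \<phi> t \<le> c"
  shows "AE x in M. X x = 1"
proof -
  have int: "integrable M (\<lambda>x. c - \<phi> (X x))" using \<phi>_int by simp
  have "expectation (\<lambda>x. c - \<phi> (X x)) = 0"
    using \<phi>_int by (simp add: c_def prob_space)
  then have "AE x in M. c - \<phi> (X x) = 0"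
    using integral_nonneg_eq_0_iff_AE[OF int] bound X_pos by simp
  then have eq: "AE x in M. (X x - 1) * \<phi> (X x) = c * (X x - 1)"
    by eventually_elim simp
  have int2: "integrable M (\<lambda>x. (X x - 1) * \<phi> (X x))"
    by (rule integrable_cong_AE_imp[where g = "\<lambda>x. c * (X x - 1)"])
      (use X_int \<phi>_int eq in auto)
  have "expectation (\<lambda>x. (X x - 1) * \<phi> (X x)) = expectation (\<lambda>x. c * (X x - 1))"
    using eq X_int \<phi>_int by (intro integral_cong_AE) auto
  also have "\<dots> = 0" using X_int X_mean by (simp add: prob_space)
  finally have "AE x in M. (X x - 1) * \<phi> (X x) = 0"
    using integral_nonneg_eq_0_iff_AE[OF int2] mult_\<phi>_nonneg X_pos by simp
  then show ?thesis
  proof (rule AE_mp, intro AE_I2 impI)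
    fix x assume x: "x \<in> space M" and z: "(X x - 1) * \<phi> (X x) = 0"
    show "X x = 1"
    proof (rule ccontr)
      assume ne: "X x \<noteq> 1"
      with z have z: "\<phi> (X x) = 0" by simp
      \<comment> \<open>The bound \<open>low\<close> reaches only up to \<open>Y\<close>. Beyond it,
        monotonicity would give \<open>\<phi> Y \<le> 0\<close>, against \<open>low\<close> at
        \<open>Y\<close> itself.\<close>
      have "X x \<le> Y"
      proof (rule ccontr)
        assume "\<not> X x \<le> Y"
        then have "\<phi> Y \<le> 0" using monotone_onD[OF \<phi>_mono, of Y "X x"] Y z by auto
        moreover have "b * (Y - 1)\<^sup>2 \<le> (Y - 1) * \<phi> Y" using low[of Y] Y by simp
        moreover have "0 < b * (Y - 1)\<^sup>2" using b Y by simp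
        ultimately show False using Y by (smt (verit) mult_nonneg_nonpos)
      qed
      then have "b * (X x - 1)\<^sup>2 \<le> 0" using low[of "X x"] X_pos[OF x] z by simp
      then show False using b ne by (smt (verit) mult_pos_pos zero_less_power2)
    qed
  qed
qed

text \<open>Some \<open>N\<close> has \<open>c \<le> \<phi> N\<close>, since otherwise the mean of
  \<open>\<phi> (X x)\<close> would lie strictly below \<open>c\<close>. For this \<open>N\<close>
  the quadratic term and the term with \<open>(X x - 1) * \<phi> (X x)\<close> in the lower bound
  for \<open>h\<close> are nonnegative; without them the bound is affine in \<open>X x\<close> and
  \<open>\<phi> (X x)\<close>, hence integrable.\<close>

lemma h_integrable_lower_bound: "\<exists>l. integrable M l \<and> (\<forall>x\<in>space M. l x \<le> h x)"
proof -
  have "\<exists>N>0. c \<le> \<phi> N"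
  proof (rule ccontr)
    assume "\<not> ?thesis"
    then have less: "\<And>t. t > 0 \<Longrightarrow> \<phi> t < c" by force
    have "expectation (\<lambda>x. \<phi> (X x)) < expectation (\<lambda>x. c)"
      by (rule expectation_less) (use less X_pos \<phi>_int in \<open>auto simp: prob_space\<close>)
    then show False by (simp add: c_def prob_space)
  qed
  then obtain N where N: "N > 0" "c \<le> \<phi> N" by blast
  define l where "l x = (N - 1) * (\<phi> (X x) - c) - N * c * (X x - 1)
    - (\<phi> N - c) * (N * X x)" for x
  have "integrable M l" unfolding l_def using X_int \<phi>_int by simp
  moreover have "l x \<le> h x" if x: "x \<in> space M" for x
  proof -
    have "0 \<le> N * ((X x - 1) * \<phi> (X x))"
      using N mult_\<phi>_nonneg[of "X x"] X_pos[OF x] by simp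
    moreover have "0 \<le> (\<phi> N - c) * (X x)\<^sup>2" using N by simp
    ultimately show ?thesis
      using h_lower_bound[OF x N(1)] unfolding l_def by (simp add: algebra_simps)
  qed
  ultimately show ?thesis by blast
qed

text \<open>If \<open>c < \<phi> N\<close> for some \<open>N\<close>, the quadratic term of the
  lower bound for \<open>h\<close> has a positive coefficient, and solving for it dominates
  \<open>(X x)\<^sup>2\<close> by an integrable function. If there is no such \<open>N\<close>, then
  \<open>X\<close> is almost surely 1.\<close>

lemma square_integrable:
  assumes b: "b > 0" and Y: "Y > 1"
    and low: "\<And>t. 0 < t \<Longrightarrow> t \<le> Y \<Longrightarrow> b * (t - 1)\<^sup>2 \<le> (t - 1) * \<phi> t"
    and h: "integrable M h"
  shows "integrable M (\<lambda>x. (X x)\<^sup>2)"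
proof (cases "\<exists>N>0. c < \<phi> N")
  case True
  then obtain N where N: "N > 0" "c < \<phi> N" by blast
  define l where "l x = (N - 1) * (\<phi> (X x) - c) - N * c * (X x - 1)
    - (\<phi> N - c) * (N * X x)" for x
  have int: "integrable M (\<lambda>x. (h x - l x) / (\<phi> N - c))"
    unfolding l_def using X_int \<phi>_int h by simp
  show ?thesis
  proof (rule Bochner_Integration.integrable_bound[OF int])
    show "(\<lambda>x. (X x)\<^sup>2) \<in> borel_measurable M" using X_int by simp
    show "AE x in M. norm ((X x)\<^sup>2) \<le> norm ((h x - l x) / (\<phi> N - c))"
    proof (rule AE_I2)
      fix x assume x: "x \<in> space M"
      have "0 \<le> N * ((X x - 1) * \<phi> (X x))"
        using N mult_\<phi>_nonneg[of "X x"] X_pos[OF x] by simp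
      then have "(\<phi> N - c) * (X x)\<^sup>2 \<le> h x - l x"
        using h_lower_bound[OF x N(1)] unfolding l_def by (simp add: algebra_simps)
      then have "(X x)\<^sup>2 \<le> (h x - l x) / (\<phi> N - c)"
        using N by (simp add: field_simps)
      then show "norm ((X x)\<^sup>2) \<le> norm ((h x - l x) / (\<phi> N - c))"
        unfolding real_norm_def by (smt (verit) zero_le_power2)
    qed
  qed
next
  case False
  then have bound: "\<phi> t \<le> c" if "t > 0" for t using that by (meson not_less)
  have "AE x in M. X x = 1"
    by (rule AE_one_if_bounded_by_mean[OF b Y low bound])
  then have AE: "AE x in M. 1 = (X x)\<^sup>2" by eventually_elim simp
  have "integrable M (\<lambda>x. 1 :: real)" by simp
  moreover have "(\<lambda>x. (X x)\<^sup>2) \<in> borel_measurable M" using X_int by simp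
  ultimately show ?thesis using AE by (rule integrable_cong_AE_imp)
qed

text \<open>Since \<open>X\<close> has mean 1, the expectation of
  \<open>(X x - 1) * \<phi> (X x)\<close> is the covariance of \<open>X\<close> and
  \<open>\<phi> (X)\<close>. With the second moment as \<open>N\<close>, the remaining terms
  \<open>l\<close> of the lower bound have mean zero and drop out. As the second moment is at least
  1, \<open>h - l\<close> also dominates the covariance integrand.\<close>

lemma second_moment_times_covariance_le:
  assumes sq: "integrable M (\<lambda>x. (X x)\<^sup>2)" and h: "integrable M h"
  shows "integrable M (\<lambda>x. (X x - 1) * \<phi> (X x))"
    and "1 \<le> expectation (\<lambda>x. (X x)\<^sup>2)"
    and "expectation (\<lambda>x. (X x)\<^sup>2) * expectation (\<lambda>x. (X x - 1) * \<phi> (X x)) \<le> expectation h"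
proof -
  let ?Z = "expectation (\<lambda>x. (X x)\<^sup>2)"
  have "0 \<le> expectation (\<lambda>x. (X x - 1)\<^sup>2)" by simp
  also have "\<dots> = expectation (\<lambda>x. (X x)\<^sup>2 - 2 * X x + 1)"
    by (simp add: power2_eq_square algebra_simps)
  also have "\<dots> = ?Z - 1" using sq X_int X_mean by (simp add: prob_space)
  finally show Z: "1 \<le> ?Z" by simp
  define l where "l x = (?Z - 1) * (\<phi> (X x) - c) - ?Z * c * (X x - 1)
    + (\<phi> ?Z - c) * ((X x)\<^sup>2 - ?Z * X x)" for x
  have l: "integrable M l" unfolding l_def using X_int \<phi>_int sq by simp
  have l0: "expectation l = 0"
    unfolding l_def using X_int \<phi>_int sq X_mean by (simp add: prob_space c_def)
  have le: "?Z * ((X x - 1) * \<phi> (X x)) \<le> h x - l x" if "x \<in> space M" for x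
    using h_lower_bound[OF that, of ?Z] Z unfolding l_def by simp
  have int: "integrable M (\<lambda>x. (h x - l x))" using h l by simp
  show K: "integrable M (\<lambda>x. (X x - 1) * \<phi> (X x))"
  proof (rule Bochner_Integration.integrable_bound[OF int])
    show "(\<lambda>x. (X x - 1) * \<phi> (X x)) \<in> borel_measurable M" using X_int \<phi>_int by simp
    show "AE x in M. norm ((X x - 1) * \<phi> (X x)) \<le> norm (h x - l x)"
    proof (rule AE_I2)
      fix x assume x: "x \<in> space M"
      have "0 \<le> (X x - 1) * \<phi> (X x)" using mult_\<phi>_nonneg X_pos[OF x] by simp
      moreover from this have "1 * ((X x - 1) * \<phi> (X x)) \<le> ?Z * ((X x - 1) * \<phi> (X x))"
        using Z by (intro mult_right_mono)
      ultimately show "norm ((X x - 1) * \<phi> (X x)) \<le> norm (h x - l x)"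
        using le[OF x] by simp
    qed
  qed
  have "?Z * expectation (\<lambda>x. (X x - 1) * \<phi> (X x))
      = expectation (\<lambda>x. ?Z * ((X x - 1) * \<phi> (X x)))" by simp
  also have "\<dots> \<le> expectation (\<lambda>x. h x - l x)"
    by (rule integral_mono) (use K int le in auto)
  also have "\<dots> = expectation h" using h l l0 by simp
  finally show "?Z * expectation (\<lambda>x. (X x - 1) * \<phi> (X x)) \<le> expectation h" .
qed

lemma expectation_h_ge_covariance:
  assumes sq: "integrable M (\<lambda>x. (X x)\<^sup>2)" and h: "integrable M h"
  shows "expectation (\<lambda>x. (X x - 1) * \<phi> (X x)) \<le> expectation h"
proof -
  note * = second_moment_times_covariance_le[OF assms]
  have "0 \<le> expectation (\<lambda>x. (X x - 1) * \<phi> (X x))"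
    using mult_\<phi>_nonneg X_pos by (intro integral_nonneg_AE AE_I2) simp
  then have "1 * expectation (\<lambda>x. (X x - 1) * \<phi> (X x))
      \<le> expectation (\<lambda>x. (X x)\<^sup>2) * expectation (\<lambda>x. (X x - 1) * \<phi> (X x))"
    using *(2) by (intro mult_right_mono)
  with *(3) show ?thesis by simp
qed

text \<open>A Markov-type estimate: up to \<open>1 + \<eta>\<close> monotonicity bounds
  \<open>\<phi> (X x)\<close>, and beyond it the factor \<open>(X x - 1) / \<eta>\<close> is at
  least 1. A covariance small compared with \<open>\<eta>\<close> thus keeps \<open>c\<close> little
  above \<open>\<phi> (1 + \<eta>)\<close>.\<close>

lemma mean_\<phi>_le:
  assumes \<eta>: "\<eta> > 0" and K: "integrable M (\<lambda>x. (X x - 1) * \<phi> (X x))"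
  shows "c \<le> \<phi> (1 + \<eta>) + expectation (\<lambda>x. (X x - 1) * \<phi> (X x)) / \<eta>"
proof -
  have "\<phi> (X x) \<le> \<phi> (1 + \<eta>) + (X x - 1) * \<phi> (X x) / \<eta>" if x: "x \<in> space M" for x
  proof (cases "X x \<le> 1 + \<eta>")
    case True
    have "0 \<le> (X x - 1) * \<phi> (X x) / \<eta>" using mult_\<phi>_nonneg X_pos[OF x] \<eta> by simp
    moreover have "\<phi> (X x) \<le> \<phi> (1 + \<eta>)"
      using monotone_onD[OF \<phi>_mono, of "X x" "1 + \<eta>"] True X_pos[OF x] \<eta> by simp
    ultimately show ?thesis by simp
  next
    case False
    have "0 \<le> \<phi> (1 + \<eta>)" "0 \<le> \<phi> (X x)"
      using monotone_onD[OF \<phi>_mono, of 1 "1 + \<eta>"] monotone_onD[OF \<phi>_mono, of 1 "X x"]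
        False \<eta> \<phi>_one by auto
    moreover from this have "\<eta> * \<phi> (X x) \<le> (X x - 1) * \<phi> (X x)"
      using False by (intro mult_right_mono) auto
    moreover from this \<eta> have "\<phi> (X x) \<le> (X x - 1) * \<phi> (X x) / \<eta>"
      by (simp add: pos_le_divide_eq mult.commute)
    ultimately show ?thesis by simp
  qed
  then have "c \<le> expectation (\<lambda>x. \<phi> (1 + \<eta>) + (X x - 1) * \<phi> (X x) / \<eta>)"
    unfolding c_def by (intro integral_mono) (use K \<phi>_int in auto)
  also have "\<dots> = \<phi> (1 + \<eta>) + expectation (\<lambda>x. (X x - 1) * \<phi> (X x)) / \<eta>"
    using K by (simp add: prob_space)
  finally show ?thesis .
qed

text \<open>
  If the covariance is large, multiply it by the second moment. If it is small, the mean \<open>c\<close> lies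
  well below \<open>\<phi> Y\<close>, so that \<open>(X - 1)\<^sup>2 (\<phi>(X) - c)\<close> controls the variance on \<open>X > Y\<close>, while
  \<open>(X - 1) \<phi>(X)\<close> controls it on \<open>X \<le> Y\<close>.
\<close>

lemma expectation_h_ge_variance:
  assumes b: "b > 0" and Y: "Y > 1" and Y_pos: "\<phi> Y > 0"
    and low: "\<And>t. 0 < t \<Longrightarrow> t \<le> Y \<Longrightarrow> b * (t - 1)\<^sup>2 \<le> (t - 1) * \<phi> t"
    and \<eta>: "\<eta> > 0" "\<phi> (1 + \<eta>) \<le> \<phi> Y / 4"
    and sq: "integrable M (\<lambda>x. (X x)\<^sup>2)" and h: "integrable M h"
  shows "min (\<eta> * \<phi> Y / 4) ((\<phi> Y / 2) / (1 + \<phi> Y / b)) * (expectation (\<lambda>x. (X x)\<^sup>2) - 1)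
    \<le> expectation h"
proof -
  let ?Z = "expectation (\<lambda>x. (X x)\<^sup>2)" and ?K = "expectation (\<lambda>x. (X x - 1) * \<phi> (X x))"
  \<comment> \<open>A covariance below \<open>?s\<close> contributes at most
    \<open>\<phi> Y / 4\<close> to the bound on \<open>c\<close>, as does
    \<open>\<phi> (1 + \<eta>)\<close>, so that \<open>c \<le> \<phi> Y / 2\<close>. The value
    \<open>?a\<close> comes from solving the last estimate of the other case for the expectation of
    \<open>h\<close>.\<close>
  let ?s = "\<eta> * \<phi> Y / 4" and ?a = "(\<phi> Y / 2) / (1 + \<phi> Y / b)"
  note K = second_moment_times_covariance_le[OF sq h]
  have s: "?s > 0" using \<eta> Y_pos by simp
  show ?thesis
  proof (cases "?s \<le> ?K")
    case True
    have "min ?s ?a * (?Z - 1) \<le> ?s * (?Z - 1)" using K(2) by (intro mult_right_mono min.cobounded1) simp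
    also have "\<dots> \<le> ?Z * ?s" using s by (simp add: algebra_simps)
    also have "\<dots> \<le> ?Z * ?K" using K(2) True by (intro mult_left_mono) auto
    also have "\<dots> \<le> expectation h" by (rule K(3))
    finally show ?thesis .
  next
    case False
    then have "?K / \<eta> \<le> \<phi> Y / 4" using \<eta> by (simp add: field_simps)
    with mean_\<phi>_le[OF \<eta>(1) K(1)] \<eta>(2) have c: "c \<le> \<phi> Y / 2" by linarith
    \<comment> \<open>The term \<open>2 * c * (X x - 1)\<close> has mean zero and turns
      \<open>h x\<close> into \<open>(X x - 1)\<^sup>2 * (\<phi> (X x) - c) + 2 * ((X x - 1) *
      \<phi> (X x))\<close>. The weight \<open>\<phi> Y / b\<close> is fitted to
      \<open>low\<close>.\<close>
    define l where "l x = h x + \<phi> Y / b * ((X x - 1) * \<phi> (X x)) + 2 * c * (X x - 1)" for x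
    have l: "integrable M l" unfolding l_def using h K(1) X_int by simp
    have E_l: "expectation l = expectation h + \<phi> Y / b * ?K"
      unfolding l_def using h K(1) X_int X_mean by (simp add: prob_space)
    have le: "\<phi> Y / 2 * (X x - 1)\<^sup>2 \<le> l x" if x: "x \<in> space M" for x
    proof -
      have eq: "l x = (X x - 1)\<^sup>2 * (\<phi> (X x) - c) + 2 * ((X x - 1) * \<phi> (X x))
          + \<phi> Y / b * ((X x - 1) * \<phi> (X x))"
        unfolding l_def h_def by (simp add: algebra_simps power2_eq_square)
      have nn: "0 \<le> (X x - 1) * \<phi> (X x)" using mult_\<phi>_nonneg X_pos[OF x] by simp
      show ?thesis
      proof (cases "X x \<le> Y")
        case True
        \<comment> \<open>The weighted term yields \<open>\<phi> Y * (X x - 1)\<^sup>2\<close>, the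
          mean \<open>c\<close> costs at most half of it, and the rest is nonnegative.\<close>
        have "\<phi> Y / b * (b * (X x - 1)\<^sup>2) \<le> \<phi> Y / b * ((X x - 1) * \<phi> (X x))"
          using low[of "X x"] True X_pos[OF x] b Y_pos by (intro mult_left_mono) auto
        moreover have "(X x - 1)\<^sup>2 * (- c) \<ge> (X x - 1)\<^sup>2 * (- \<phi> Y / 2)"
          using c by (intro mult_left_mono) auto
        moreover have "2 * ((X x - 1) * \<phi> (X x)) + (X x - 1)\<^sup>2 * \<phi> (X x) \<ge> 0"
        proof -
          have "2 * ((X x - 1) * \<phi> (X x)) + (X x - 1)\<^sup>2 * \<phi> (X x)
              = (X x + 1) * ((X x - 1) * \<phi> (X x))"
            by (simp add: algebra_simps power2_eq_square)
          also have "\<dots> \<ge> 0" using nn X_pos[OF x] by simp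
          finally show ?thesis .
        qed
        ultimately show ?thesis unfolding eq using b by (simp add: algebra_simps)
      next
        case False
        then have "\<phi> Y \<le> \<phi> (X x)"
          using monotone_onD[OF \<phi>_mono, of Y "X x"] Y by simp
        then have "(X x - 1)\<^sup>2 * (\<phi> Y / 2) \<le> (X x - 1)\<^sup>2 * (\<phi> (X x) - c)"
          using c by (intro mult_left_mono) auto
        moreover have "0 \<le> \<phi> Y / b * ((X x - 1) * \<phi> (X x))" using nn b Y_pos by simp
        ultimately show ?thesis unfolding eq using nn by (simp add: algebra_simps)
      qed
    qed
    have sq': "(\<lambda>x. (X x - 1)\<^sup>2) = (\<lambda>x. (X x)\<^sup>2 - 2 * X x + 1)"
      by (auto simp: power2_eq_square algebra_simps)
    have "expectation (\<lambda>x. (X x - 1)\<^sup>2) = ?Z - 1"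
      unfolding sq' using sq X_int X_mean by (simp add: prob_space)
    then have "\<phi> Y / 2 * (?Z - 1) = expectation (\<lambda>x. \<phi> Y / 2 * (X x - 1)\<^sup>2)" by simp
    also have "\<dots> \<le> expectation l"
      by (rule integral_mono) (use l le sq X_int in \<open>auto simp: sq'\<close>)
    \<comment> \<open>The covariance is itself at most the expectation of \<open>h\<close>, so it is
      absorbed at the price of a constant factor.\<close>
    also have "\<dots> \<le> expectation h + \<phi> Y / b * expectation h"
      unfolding E_l using expectation_h_ge_covariance[OF sq h] b Y_pos
      by (intro add_left_mono mult_left_mono) auto
    also have "\<dots> = (1 + \<phi> Y / b) * expectation h" by (simp add: algebra_simps)
    finally have "\<phi> Y / 2 * (?Z - 1) \<le> (1 + \<phi> Y / b) * expectation h" .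
    moreover have "1 + \<phi> Y / b > 0" using b Y_pos by (simp add: add_pos_pos)
    ultimately have "\<phi> Y / 2 * (?Z - 1) / (1 + \<phi> Y / b) \<le> expectation h"
      by (subst pos_divide_le_eq) (simp_all only: mult.commute)
    then have "?a * (?Z - 1) \<le> expectation h" by (simp only: times_divide_eq_left)
    moreover have "min ?s ?a * (?Z - 1) \<le> ?a * (?Z - 1)"
      using K(2) by (intro mult_right_mono min.cobounded2) simp
    ultimately show ?thesis by simp
  qed
qed

end

theorem theorem5p2:
  fixes f :: "real \<Rightarrow> real"
  assumes "f C1_differentiable_on {0<..}"
    and "deriv f C1_differentiable_on {0<..}"
    and "convex_on {0<..} f"
    and "f 1 = 0"
    and "deriv (deriv f) 1 > 0"
  shows "\<exists>\<alpha>::real. \<alpha> > 0 \<and>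
    (\<forall>d::nat. d \<ge> 1 \<longrightarrow>
      (\<forall>\<rho> \<rho>' :: (nat \<Rightarrow> real) \<Rightarrow> real.
        positive_density d \<rho> \<longrightarrow> positive_density d \<rho>' \<longrightarrow>
        integrable (lebesgue_Rd d) (\<lambda>\<theta>. \<rho> \<theta> * deriv f (\<rho> \<theta> / \<rho>' \<theta>)) \<longrightarrow>
          quasi_integrable (lebesgue_Rd d) (f_div_integrand f \<rho> \<rho>') \<and>
          f_div f d \<rho> \<rho>' > -\<infinity> \<and>
          quasi_integrable (lebesgue_Rd d) (dissipation_integrand f d \<rho> \<rho>') \<and>
          - ext_integral (lebesgue_Rd d) (dissipation_integrand f d \<rho> \<rho>') > -\<infinity> \<and>
          - ext_integral (lebesgue_Rd d) (dissipation_integrand f d \<rho> \<rho>') \<ge> f_div f d \<rho> \<rho>' \<and>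
          - ext_integral (lebesgue_Rd d) (dissipation_integrand f d \<rho> \<rho>')
              \<ge> ereal \<alpha> * chi2_div d \<rho>' \<rho>))"
proof -

  \<comment> \<open>Convexity of \<open>f\<close> and monotonicity of \<open>\<phi>\<close>\<close>
  define \<phi> where "\<phi> t = deriv f 1 - deriv f (1 / t)" for t :: real
  have df: "(f has_real_derivative deriv f x) (at x)" if "x > 0" for x
  proof -
    have "f differentiable at x" using assms(1) that by (auto simp: C1_differentiable_on_eq)
    then show ?thesis
      by (metis DERIV_imp_deriv real_differentiable_def)
  qed
  have ddf: "(deriv f has_real_derivative deriv (deriv f) 1) (at 1)"
  proof -
    have "deriv f differentiable at 1" using assms(2) by (auto simp: C1_differentiable_on_eq)
    then show ?thesis
      by (metis DERIV_imp_deriv real_differentiable_def)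
  qed
  have tangent: "f x + deriv f x * (y - x) \<le> f y" if "x > 0" "y > 0" for x y
  proof -
    have "f y - f x \<ge> deriv f x * (y - x)"
      by (rule convex_on_imp_above_tangent[OF assms(3)])
        (use that df[of x] in \<open>auto intro: has_field_derivative_at_within simp: interior_open\<close>)
    then show ?thesis by simp
  qed
  have f'_mono: "deriv f x \<le> deriv f y" if "0 < x" "x \<le> y" for x y
  proof (cases "x = y")
    case False
    have "deriv f x * (y - x) \<le> deriv f y * (y - x)"
      using tangent[of x y] tangent[of y x] that by (simp add: algebra_simps)
    then show ?thesis using that False by simp
  qed simp
  have \<phi>_mono: "mono_on {0<..} \<phi>"
    by (auto intro!: mono_onI f'_mono simp: \<phi>_def frac_le)
  have \<phi>_one: "\<phi> 1 = 0" by (simp add: \<phi>_def)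
  have f_cont: "continuous_on {0<..} f"
    using df by (auto intro!: continuous_at_imp_continuous_on DERIV_isCont)

  \<comment> \<open>Quadratic growth of \<open>(t - 1) * \<phi> t\<close> up to a point
    \<open>Y > 1\<close>\<close>
  define m where "m = deriv (deriv f) 1 / 2"
  have m: "m > 0" using assms(5) by (simp add: m_def)
  have d\<phi>: "(\<phi> has_real_derivative 2 * m) (at 1)"
  proof -
    have "((\<lambda>t::real. 1 / t) has_real_derivative -1) (at 1)"
      by (auto intro!: derivative_eq_intros)
    from DERIV_chain2[OF _ this, of "deriv f" "2 * m"] ddf
    have "((\<lambda>t. deriv f (1 / t)) has_real_derivative 2 * m * -1) (at 1)" by (simp add: m_def)
    from DERIV_diff[OF DERIV_const this, of "deriv f 1"] show ?thesis
      by (simp add: \<phi>_def[abs_def])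
  qed
  \<comment> \<open>The difference quotients tend to \<open>2 * m\<close>, the second derivative of
    \<open>f\<close> at 1, so they exceed half of it near 1.\<close>
  have "eventually (\<lambda>t. (\<phi> t - \<phi> 1) / (t - 1) > m) (at 1)"
    using d\<phi> m unfolding has_field_derivative_iff by (intro order_tendstoD) auto
  then obtain \<delta>' where \<delta>': "\<delta>' > 0"
    "\<And>t. t \<noteq> 1 \<Longrightarrow> dist t 1 < \<delta>' \<Longrightarrow> (\<phi> t - \<phi> 1) / (t - 1) > m"
    unfolding eventually_at by blast
  \<comment> \<open>Being below \<open>\<delta>'\<close>, this radius allows the closed interval;
    being below 1, it keeps \<open>1 - \<delta>\<close> in the domain where \<open>\<phi>\<close> is
    monotone.\<close>
  define \<delta> where "\<delta> = min (\<delta>' / 2) (1 / 2)"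
  have \<delta>: "\<delta> > 0" "\<delta> < 1" "\<delta> < \<delta>'" using \<delta>' by (auto simp: \<delta>_def)
  have near: "m * (t - 1)\<^sup>2 \<le> (t - 1) * \<phi> t" if "\<bar>t - 1\<bar> \<le> \<delta>" for t
  proof (cases "t = 1")
    case False
    have "m \<le> \<phi> t / (t - 1)"
      using \<delta>'(2)[of t] False that \<delta> by (simp add: \<phi>_one dist_real_def)
    then have "m * (t - 1)\<^sup>2 \<le> \<phi> t / (t - 1) * (t - 1)\<^sup>2" by (rule mult_right_mono) simp
    also have "\<dots> = (t - 1) * \<phi> t" using False by (simp add: power2_eq_square)
    finally show ?thesis .
  qed simp
  define Y where "Y = 1 + \<delta>"
  \<comment> \<open>This is the bound on \<open>- \<phi> (1 - \<delta>)\<close> that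
    \<open>near\<close> provides. As \<open>\<delta> < 1\<close>, it is at most \<open>m\<close> and
    so serves near 1 as well.\<close>
  define b where "b = m * \<delta>"
  have b: "b > 0" using m \<delta> by (simp add: b_def)
  have Y: "Y > 1" using \<delta> by (simp add: Y_def)
  have bm: "b \<le> m" using m \<delta> by (simp add: b_def)
  have Y_pos: "\<phi> Y > 0"
  proof -
    have "0 < m * (Y - 1)\<^sup>2" using m Y by simp
    also have "\<dots> \<le> (Y - 1) * \<phi> Y" using near[of Y] \<delta> by (simp add: Y_def)
    finally show ?thesis using Y by (simp add: zero_less_mult_iff)
  qed
  have low: "b * (t - 1)\<^sup>2 \<le> (t - 1) * \<phi> t" if t: "0 < t" "t \<le> Y" for t
  proof (cases "t \<ge> 1 - \<delta>")
    case True
    then have "m * (t - 1)\<^sup>2 \<le> (t - 1) * \<phi> t" using near[of t] t by (simp add: Y_def)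
    moreover have "b * (t - 1)\<^sup>2 \<le> m * (t - 1)\<^sup>2" using bm by (intro mult_right_mono) auto
    ultimately show ?thesis by simp
  next
    case False
    \<comment> \<open>Left of \<open>1 - \<delta>\<close>, monotonicity carries the bound at
      \<open>1 - \<delta>\<close> over to \<open>t\<close>, and
      \<open>(1 - t)\<^sup>2 \<le> 1 - t\<close> since \<open>0 < t < 1\<close>.\<close>
    have "\<delta> * b \<le> - (\<delta> * \<phi> (1 - \<delta>))"
      using near[of "1 - \<delta>"] \<delta> by (simp add: b_def power2_eq_square algebra_simps)
    then have "\<delta> * b \<le> \<delta> * - \<phi> (1 - \<delta>)" by simp
    then have "b \<le> - \<phi> (1 - \<delta>)" using \<delta> by (simp only: mult_le_cancel_left_pos)
    also have "\<dots> \<le> - \<phi> t" using monotone_onD[OF \<phi>_mono, of t "1 - \<delta>"] False t \<delta> by simp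
    finally have "b * (1 - t) \<le> - \<phi> t * (1 - t)" using False \<delta> by (intro mult_right_mono) auto
    moreover have "b * (1 - t)\<^sup>2 \<le> b * (1 - t)"
      using b t False \<delta> by (intro mult_left_mono) (auto simp: power2_eq_square mult_left_le)
    ultimately show ?thesis by (simp add: power2_eq_square algebra_simps)
  qed
  \<comment> \<open>Such a point exists because \<open>\<phi>\<close> is continuous at 1 and
    vanishes there, while \<open>\<phi> Y > 0\<close>.\<close>
  obtain \<eta> where \<eta>: "\<eta> > 0" "\<phi> (1 + \<eta>) \<le> \<phi> Y / 4"
  proof -
    have "isCont \<phi> 1" using d\<phi> by (rule DERIV_isCont)
    then have "eventually (\<lambda>t. \<phi> t < \<phi> Y / 4) (at 1)"
      unfolding isCont_def using Y_pos \<phi>_one by (intro order_tendstoD) auto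
    then obtain e where e: "e > 0" "\<And>t. t \<noteq> 1 \<Longrightarrow> dist t 1 < e \<Longrightarrow> \<phi> t < \<phi> Y / 4"
      unfolding eventually_at by blast
    show ?thesis using that[of "e / 2"] e(1) e(2)[of "1 + e / 2"] by (simp add: dist_real_def)
  qed

  \<comment> \<open>All ingredients come from \<open>f\<close> alone and are fixed before the
    dimension and the densities.\<close>
  define \<alpha> where "\<alpha> = min (\<eta> * \<phi> Y / 4) ((\<phi> Y / 2) / (1 + \<phi> Y / b))"
  have \<alpha>: "\<alpha> > 0" using \<eta> Y_pos b by (simp add: \<alpha>_def add_pos_pos)
  show ?thesis
  proof (intro exI[of _ \<alpha>] conjI[OF \<alpha>] allI impI)
    fix d :: nat and \<rho> \<rho>' :: "(nat \<Rightarrow> real) \<Rightarrow> real"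
    assume \<rho>: "positive_density d \<rho>" and \<rho>': "positive_density d \<rho>'"
      and int: "integrable (lebesgue_Rd d) (\<lambda>\<theta>. \<rho> \<theta> * deriv f (\<rho> \<theta> / \<rho>' \<theta>))"

    \<comment> \<open>Passage to the density ratio under the probability measure of
      \<open>\<rho>\<close>\<close>
    let ?L = "lebesgue_Rd d"
    define P where "P = density ?L \<rho>"
    define X where "X \<theta> = \<rho>' \<theta> / \<rho> \<theta>" for \<theta>
    have [measurable]: "\<rho> \<in> borel_measurable ?L" "\<rho>' \<in> borel_measurable ?L"
      using \<rho> \<rho>' by (auto simp: positive_density_def)
    have pos: "\<rho> \<theta> > 0" "\<rho>' \<theta> > 0" if "\<theta> \<in> space ?L" for \<theta>
      using \<rho> \<rho>' that by (auto simp: positive_density_def)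
    have AE_nn: "AE \<theta> in ?L. 0 \<le> \<rho> \<theta>" "AE \<theta> in ?L. 0 \<le> \<rho>' \<theta>"
      using pos by (auto intro!: AE_I2 less_imp_le)
    have space_P [simp]: "space P = space ?L" by (simp add: P_def)
    have meas_P: "borel_measurable P = borel_measurable ?L"
      by (simp add: P_def measurable_density_eq2 cong: measurable_cong_sets)
    have [measurable]: "X \<in> borel_measurable ?L" unfolding X_def[abs_def] by measurable
    have inv_X: "1 / X \<theta> = \<rho> \<theta> / \<rho>' \<theta>" for \<theta> by (simp add: X_def)
    have integrable_P: "integrable P g \<longleftrightarrow> integrable ?L (\<lambda>\<theta>. \<rho> \<theta> * g \<theta>)"
      and integral_P: "integral\<^sup>L P g = (\<integral>\<theta>. \<rho> \<theta> * g \<theta> \<partial>?L)"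
      if "g \<in> borel_measurable ?L" for g :: "_ \<Rightarrow> real"
      unfolding P_def using that AE_nn
      by (auto simp: integrable_density integral_density)
    have ext_P: "ext_integral P g = ext_integral ?L (\<lambda>\<theta>. \<rho> \<theta> * g \<theta>)"
      and quasi_P: "quasi_integrable P g \<Longrightarrow> quasi_integrable ?L (\<lambda>\<theta>. \<rho> \<theta> * g \<theta>)"
      if "g \<in> borel_measurable ?L" for g
      unfolding P_def using pos that
      by (simp_all add: ext_integral_density quasi_integrable_density less_imp_le)
    have "prob_space P"
    proof
      show "emeasure P (space P) = 1"
        using \<rho> by (simp add: P_def emeasure_density positive_density_def
            cong: nn_integral_cong_simp)
    qed
    then interpret prob_space P .
    have prob_space_L [simp]: "prob (space ?L) = 1" using prob_space by simp
    have \<rho>'_int: "integrable ?L \<rho>'" "integral\<^sup>L ?L \<rho>' = 1"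
    proof -
      have "(\<integral>\<^sup>+\<theta>. ennreal (\<rho>' \<theta>) \<partial>?L) = ennreal 1" using \<rho>' by (simp add: positive_density_def)
      then have "has_bochner_integral ?L \<rho>' 1"
        using AE_nn by (intro has_bochner_integral_nn_integral) auto
      then show "integrable ?L \<rho>'" "integral\<^sup>L ?L \<rho>' = 1"
        by (auto simp: has_bochner_integral_iff)
    qed
    have \<rho>X: "\<rho> \<theta> * X \<theta> = \<rho>' \<theta>" if "\<theta> \<in> space ?L" for \<theta>
      using pos[OF that] by (simp add: X_def)
    have f'_meas: "(\<lambda>\<theta>. deriv f (1 / X \<theta>)) \<in> borel_measurable ?L"
    proof -
      \<comment> \<open>Measurability of the product is part of the integrability hypothesis; the
        positive factor \<open>\<rho>\<close> is divided out.\<close>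
      have "(\<lambda>\<theta>. \<rho> \<theta> * deriv f (\<rho> \<theta> / \<rho>' \<theta>) / \<rho> \<theta>) \<in> borel_measurable ?L"
        using int by (intro borel_measurable_divide) auto
      also have "?this \<longleftrightarrow> ?thesis"
        using pos by (intro measurable_cong) (auto simp: inv_X less_imp_neq[symmetric])
      finally show ?thesis .
    qed
    have f'_int: "integrable P (\<lambda>\<theta>. deriv f (1 / X \<theta>))"
      using int f'_meas by (simp add: integrable_P inv_X)
    interpret unit_mean_variable P X \<phi>
    proof
      show "X \<theta> > 0" if "\<theta> \<in> space P" for \<theta> using pos that by (simp add: X_def)
      show "integrable P X"
        using \<rho>'_int \<rho>X by (simp add: integrable_P cong: Bochner_Integration.integrable_cong)
      show "expectation X = 1"
        using \<rho>'_int \<rho>X by (simp add: integral_P cong: Bochner_Integration.integral_cong)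
      show "integrable P (\<lambda>x. \<phi> (X x))" unfolding \<phi>_def using f'_int by simp
    qed (fact \<phi>_mono \<phi>_one)+

    \<comment> \<open>The divergence through the adjoint function
      \<open>t * f (1 / t)\<close>\<close>
    define F where "F \<theta> = X \<theta> * f (1 / X \<theta>)" for \<theta>
    have F_meas: "F \<in> borel_measurable ?L"
    proof -
      have "(\<lambda>\<theta>. f (1 / X \<theta>)) \<in> borel_measurable ?L"
        by (rule measurable_compose_rev[OF borel_measurable_continuous_on_restrict[OF f_cont]])
          (use X_pos in \<open>auto intro!: measurable_restrict_space2\<close>)
      then show ?thesis unfolding F_def[abs_def] by measurable
    qed
    have F_eq: "f_div_integrand f \<rho> \<rho>' \<theta> = \<rho> \<theta> * F \<theta>" if "\<theta> \<in> space ?L" for \<theta>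
      using pos[OF that] unfolding f_div_integrand_def F_def inv_X by (simp add: X_def)
    have F_lower: "deriv f 1 * (1 - X \<theta>) \<le> F \<theta>" if "\<theta> \<in> space P" for \<theta>
    proof -
      \<comment> \<open>The tangent at 1, evaluated at \<open>1 / X \<theta>\<close>, gives an
        integrable minorant.\<close>
      have "X \<theta> * (deriv f 1 * (1 / X \<theta> - 1)) \<le> F \<theta>"
        unfolding F_def using tangent[of 1 "1 / X \<theta>"] X_pos[OF that] assms(4)
        by (intro mult_left_mono) auto
      then show ?thesis using X_pos[OF that] by (simp add: algebra_simps)
    qed
    have F_upper: "F \<theta> \<le> (X \<theta> - 1) * \<phi> (X \<theta>) - deriv f 1 * (X \<theta> - 1)" if "\<theta> \<in> space P" for \<theta>
    proof -
      \<comment> \<open>Now the tangent at \<open>1 / X \<theta>\<close> is evaluated at 1. The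
        result is the covariance integrand up to a term of mean zero.\<close>
      have "F \<theta> \<le> X \<theta> * (deriv f (1 / X \<theta>) * (1 / X \<theta> - 1))"
        unfolding F_def using tangent[of "1 / X \<theta>" 1] X_pos[OF that] assms(4)
        by (intro mult_left_mono) (auto simp: algebra_simps)
      also have "\<dots> = (X \<theta> - 1) * \<phi> (X \<theta>) - deriv f 1 * (X \<theta> - 1)"
        using X_pos[OF that] by (simp add: \<phi>_def field_simps)
      finally show ?thesis .
    qed
    have F_lower_int: "integrable P (\<lambda>\<theta>. deriv f 1 * (1 - X \<theta>))" using X_int by simp
    have f_div_eq: "f_div f d \<rho> \<rho>' = ext_integral P F"
      unfolding f_div_def ext_P[OF F_meas] using F_eq by (rule ext_integral_cong)
    have F_quasi: "quasi_integrable P F" "ext_integral P F > -\<infinity>"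
      using quasi_integrable_lower_bound[OF _ F_lower_int F_lower] F_meas meas_P by auto
    have f_div_quasi: "quasi_integrable ?L (f_div_integrand f \<rho> \<rho>')"
      using quasi_P[OF F_meas F_quasi(1)] by (subst quasi_integrable_cong[OF F_eq])

    \<comment> \<open>The dissipation as an expectation of \<open>h\<close>\<close>
    have mean: "density_expectation d \<rho> (\<lambda>\<eta>. deriv f (\<rho> \<eta> / \<rho>' \<eta>)) = deriv f 1 - c"
    proof -
      have "c = deriv f 1 - expectation (\<lambda>\<theta>. deriv f (1 / X \<theta>))"
        unfolding c_def \<phi>_def using f'_int by (simp add: prob_space)
      also have "expectation (\<lambda>\<theta>. deriv f (1 / X \<theta>))
          = density_expectation d \<rho> (\<lambda>\<eta>. deriv f (\<rho> \<eta> / \<rho>' \<eta>))"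
        using f'_meas by (simp add: integral_P density_expectation_def inv_X)
      finally show ?thesis by simp
    qed
    \<comment> \<open>Subtracting the mean cancels the constant \<open>deriv f 1\<close> that
      normalises \<open>\<phi>\<close>, so \<open>\<phi> (X \<theta>) - c\<close> is minus the
      centred \<open>deriv f (\<rho> \<theta> / \<rho>' \<theta>)\<close>.\<close>
    have diss_eq: "dissipation_integrand f d \<rho> \<rho>' \<theta> = \<rho> \<theta> * - h \<theta>" for \<theta>
      unfolding dissipation_integrand_def mean h_def \<phi>_def inv_X
      by (simp add: X_def algebra_simps)
    have h_meas: "h \<in> borel_measurable ?L" using h_measurable by (simp add: meas_P)
    have diss_ext: "ext_integral ?L (dissipation_integrand f d \<rho> \<rho>') = ext_integral P (\<lambda>\<theta>. - h \<theta>)"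
      using ext_P[of "\<lambda>\<theta>. - h \<theta>"] h_meas by (simp add: diss_eq[abs_def])
    obtain l where l: "integrable P l" "\<And>\<theta>. \<theta> \<in> space P \<Longrightarrow> l \<theta> \<le> h \<theta>"
      using h_integrable_lower_bound by blast
    have diss_quasi: "quasi_integrable ?L (dissipation_integrand f d \<rho> \<rho>')"
    proof -
      have "quasi_integrable P (\<lambda>\<theta>. - h \<theta>)"
        using quasi_integrable_lower_bound(1)[OF h_measurable l] by (simp add: quasi_integrable_uminus)
      then have "quasi_integrable ?L (\<lambda>\<theta>. \<rho> \<theta> * - h \<theta>)"
        using h_meas by (intro quasi_P) auto
      then show ?thesis by (simp add: diss_eq[abs_def])
    qed

    \<comment> \<open>The two inequalities\<close>
    have main: "- ext_integral P (\<lambda>\<theta>. - h \<theta>) > -\<infinity> \<and>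
      ext_integral P F \<le> - ext_integral P (\<lambda>\<theta>. - h \<theta>) \<and>
      ereal \<alpha> * chi2_div d \<rho>' \<rho> \<le> - ext_integral P (\<lambda>\<theta>. - h \<theta>)"
    \<comment> \<open>Infinite dissipation makes all claims trivial. If it is finite,
      \<open>h\<close> and therefore \<open>(X \<theta>)\<^sup>2\<close> are integrable, so that the
      divergence and chi-square are finite too.\<close>
    proof (rule ext_integral_uminus_cases[of h P l])
      assume 1: "integrable P h" "- ext_integral P (\<lambda>\<theta>. - h \<theta>) = ereal (expectation h)"
      have sq: "integrable P (\<lambda>\<theta>. (X \<theta>)\<^sup>2)"
        by (rule square_integrable[OF b Y low 1(1)])
      note K = second_moment_times_covariance_le[OF sq 1(1)]
      have up_int: "integrable P (\<lambda>\<theta>. (X \<theta> - 1) * \<phi> (X \<theta>) - deriv f 1 * (X \<theta> - 1))"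
        using K(1) X_int by simp
      have F_int: "integrable P F"
      proof (rule Bochner_Integration.integrable_bound)
        show "integrable P (\<lambda>\<theta>. \<bar>(X \<theta> - 1) * \<phi> (X \<theta>) - deriv f 1 * (X \<theta> - 1)\<bar>
            + \<bar>deriv f 1 * (1 - X \<theta>)\<bar>)"
          using up_int F_lower_int by (intro Bochner_Integration.integrable_add integrable_abs)
        show "AE \<theta> in P. norm (F \<theta>) \<le> norm (\<bar>(X \<theta> - 1) * \<phi> (X \<theta>) - deriv f 1 * (X \<theta> - 1)\<bar>
            + \<bar>deriv f 1 * (1 - X \<theta>)\<bar>)"
          using F_lower F_upper by (intro AE_I2) (smt (verit) real_norm_def)
      qed (simp add: meas_P F_meas)
      have "expectation F \<le> expectation (\<lambda>\<theta>. (X \<theta> - 1) * \<phi> (X \<theta>) - deriv f 1 * (X \<theta> - 1))"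
        by (intro integral_mono F_int up_int F_upper)
      also have "\<dots> = expectation (\<lambda>\<theta>. (X \<theta> - 1) * \<phi> (X \<theta>))"
        using K(1) X_int X_mean by (simp add: prob_space)
      also have "\<dots> \<le> expectation h" by (rule expectation_h_ge_covariance[OF sq 1(1)])
      finally have "expectation F \<le> expectation h" .
      moreover have "chi2_div d \<rho>' \<rho> = ereal (expectation (\<lambda>\<theta>. (X \<theta>)\<^sup>2) - 1)"
      proof -
        have "(\<integral>\<^sup>+\<theta>. ennreal ((\<rho>' \<theta>)\<^sup>2 / \<rho> \<theta>) \<partial>?L) = (\<integral>\<^sup>+\<theta>. ennreal ((X \<theta>)\<^sup>2) \<partial>P)"
          unfolding P_def using pos
          by (subst nn_integral_density)
            (auto simp: X_def power2_eq_square less_imp_le less_imp_neq[symmetric]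
              simp flip: ennreal_mult' intro!: nn_integral_cong)
        also have "\<dots> = ennreal (expectation (\<lambda>\<theta>. (X \<theta>)\<^sup>2))"
          by (rule nn_integral_eq_integral[OF sq]) simp
        finally show ?thesis by (simp add: chi2_div_def one_ereal_def)
      qed
      moreover have "\<alpha> * (expectation (\<lambda>\<theta>. (X \<theta>)\<^sup>2) - 1) \<le> expectation h"
        unfolding \<alpha>_def by (rule expectation_h_ge_variance[OF b Y Y_pos low \<eta> sq 1(1)])
      ultimately show ?thesis
        using ext_integral_integrable[OF F_int] 1(2) by simp
    qed (use h_measurable l in simp_all)
    show "quasi_integrable ?L (f_div_integrand f \<rho> \<rho>') \<and>
          f_div f d \<rho> \<rho>' > -\<infinity> \<and>
          quasi_integrable ?L (dissipation_integrand f d \<rho> \<rho>') \<and>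
          - ext_integral ?L (dissipation_integrand f d \<rho> \<rho>') > -\<infinity> \<and>
          - ext_integral ?L (dissipation_integrand f d \<rho> \<rho>') \<ge> f_div f d \<rho> \<rho>' \<and>
          - ext_integral ?L (dissipation_integrand f d \<rho> \<rho>') \<ge> ereal \<alpha> * chi2_div d \<rho>' \<rho>"
      using f_div_quasi F_quasi(2) diss_quasi main unfolding f_div_eq diss_ext by blast
  qed
qed

end
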